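(* Let $1\le\theta_1\le\theta_2$. If a sequence $(\mathcal X_i)_i$ of compact $\theta_1$-metric spaces is convergent in the $\theta_1$-Gromov-Hausdorff topology, then it converges to the same limit in the $\theta_2$-Gromov-Hausdorff topology.
   Context: An irreversible metric on $X$ is $d:X\times X\to[0,\infty)$ with $d(x,y)=0$ iff $x=y$ and $d(x,z)\le d(x,y)+d(y,z)$ (no symmetry). The topology is generated by the forward balls $\{y:d(x,y)<r\}$. $(X,d)$ is a $\theta$-metric space if $d(x,y)\le\theta\,d(y,x)$ for all $x,y$. For $A\subset X$, $A^\epsilon=\{x\in X:\inf_{a\in A}d(a,x)<\epsilon\}$ and $d_H(A,B)=\inf\{\epsilon>0:A\subset B^\epsilon,B\subset A^\epsilon\}$. A $\theta$-admissible metric on $X_1\sqcup X_2$ is an irreversible metric making $X_1\sqcup X_2$ a $\theta$-metric space and restricting to $d_i$ on $X_i$. The $\theta$-Gromov-Hausdorff distance $d^\theta_{GH}$ of two compact $\theta$-metric spaces is the infimum of $d_H(X_1,X_2)$ over $\theta$-admissible metrics on $X_1\sqcup X_2$; $(\mathcal X_i)_i$ converges to a compact $\theta$-metric space $\mathcal X$ in the $\theta$-Gromov-Hausdorff topology if $d^\theta_{GH}(\mathcal X_i,\mathcal X)\to0$. *)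

theory Defs
  imports "HOL-Analysis.Analysis"
begin

locale irreversible_metric_space =
  fixes M :: "'a set" and d :: "'a \<Rightarrow> 'a \<Rightarrow> real"
  assumes nonneg: "\<lbrakk>x \<in> M; y \<in> M\<rbrakk> \<Longrightarrow> 0 \<le> d x y"
    and zero_iff: "\<lbrakk>x \<in> M; y \<in> M\<rbrakk> \<Longrightarrow> d x y = 0 \<longleftrightarrow> x = y"
    and triangle: "\<lbrakk>x \<in> M; y \<in> M; z \<in> M\<rbrakk> \<Longrightarrow> d x z \<le> d x y + d y z"

definition forward_ball :: "'a set \<Rightarrow> ('a \<Rightarrow> 'a \<Rightarrow> real) \<Rightarrow> 'a \<Rightarrow> real \<Rightarrow> 'a set" where
  "forward_ball M d x r = {y \<in> M. d x y < r}"

definition forward_topology :: "'a set \<Rightarrow> ('a \<Rightarrow> 'a \<Rightarrow> real) \<Rightarrow> 'a topology" where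
  "forward_topology M d = topology_generated_by {forward_ball M d x r | x r. x \<in> M \<and> 0 < r}"

lemma (in irreversible_metric_space) topspace_forward_topology:
  "topspace (forward_topology M d) = M"
proof -
  have "x \<in> forward_ball M d x 1" if "x \<in> M" for x
    using that zero_iff[of x x] by (simp add: forward_ball_def)
  moreover have "forward_ball M d x r \<subseteq> M" for x r
    by (auto simp: forward_ball_def)
  ultimately show ?thesis
    unfolding forward_topology_def topology_generated_by_topspace
    using zero_less_one[where 'a = real] by blast
qed

locale theta_metric_space = irreversible_metric_space M d
  for \<theta> :: real and M :: "'a set" and d :: "'a \<Rightarrow> 'a \<Rightarrow> real" +
  assumes theta_bound: "\<lbrakk>x \<in> M; y \<in> M\<rbrakk> \<Longrightarrow> d x y \<le> \<theta> * d y x"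

definition compact_theta_metric_space ::
  "real \<Rightarrow> 'a set \<Rightarrow> ('a \<Rightarrow> 'a \<Rightarrow> real) \<Rightarrow> bool" where
  "compact_theta_metric_space \<theta> M d \<longleftrightarrow>
     theta_metric_space \<theta> M d \<and> compact_space (forward_topology M d)"

text \<open>Infima are taken in the extended reals, so that the infimum of the empty set is
  infinity. In particular the neighbourhood of the empty set is empty.\<close>

definition forward_nbhd ::
  "'a set \<Rightarrow> ('a \<Rightarrow> 'a \<Rightarrow> real) \<Rightarrow> 'a set \<Rightarrow> real \<Rightarrow> 'a set" where
  "forward_nbhd M d A \<epsilon> = {x \<in> M. (INF a\<in>A. ereal (d a x)) < ereal \<epsilon>}"

definition irreversible_hausdorff ::
  "'a set \<Rightarrow> ('a \<Rightarrow> 'a \<Rightarrow> real) \<Rightarrow> 'a set \<Rightarrow> 'a set \<Rightarrow> ereal" where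
  "irreversible_hausdorff M d A B =
     Inf {ereal \<epsilon> | \<epsilon>. 0 < \<epsilon> \<and> A \<subseteq> forward_nbhd M d B \<epsilon> \<and> B \<subseteq> forward_nbhd M d A \<epsilon>}"

definition theta_admissible ::
  "real \<Rightarrow> 'a set \<Rightarrow> ('a \<Rightarrow> 'a \<Rightarrow> real) \<Rightarrow> 'b set \<Rightarrow> ('b \<Rightarrow> 'b \<Rightarrow> real) \<Rightarrow>
     ('a + 'b \<Rightarrow> 'a + 'b \<Rightarrow> real) \<Rightarrow> bool" where
  "theta_admissible \<theta> M1 d1 M2 d2 d \<longleftrightarrow>
     theta_metric_space \<theta> (M1 <+> M2) d \<and>
     (\<forall>x\<in>M1. \<forall>y\<in>M1. d (Inl x) (Inl y) = d1 x y) \<and>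
     (\<forall>x\<in>M2. \<forall>y\<in>M2. d (Inr x) (Inr y) = d2 x y)"

definition theta_GH_dist ::
  "real \<Rightarrow> 'a set \<Rightarrow> ('a \<Rightarrow> 'a \<Rightarrow> real) \<Rightarrow> 'b set \<Rightarrow> ('b \<Rightarrow> 'b \<Rightarrow> real) \<Rightarrow> ereal" where
  "theta_GH_dist \<theta> M1 d1 M2 d2 =
     (INF d \<in> {d. theta_admissible \<theta> M1 d1 M2 d2 d}.
        irreversible_hausdorff (M1 <+> M2) d (Inl ` M1) (Inr ` M2))"

definition theta_GH_converges ::
  "real \<Rightarrow> (nat \<Rightarrow> 'a set) \<Rightarrow> (nat \<Rightarrow> 'a \<Rightarrow> 'a \<Rightarrow> real) \<Rightarrow>
     'b set \<Rightarrow> ('b \<Rightarrow> 'b \<Rightarrow> real) \<Rightarrow> bool" where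
  "theta_GH_converges \<theta> X dX Y dY \<longleftrightarrow>
     (\<forall>i. compact_theta_metric_space \<theta> (X i) (dX i)) \<and>
     compact_theta_metric_space \<theta> Y dY \<and>
     (\<lambda>i. theta_GH_dist \<theta> (X i) (dX i) Y dY) \<longlonglongrightarrow> 0"

end

theory Submission
  imports Defs
begin

text \<open>Raising \<theta> only weakens the bound on asymmetry, so every \<theta>1-admissible
  metric on the disjoint union is \<theta>2-admissible (\<open>theta_admissible_mono\<close>). The
  distance for \<theta>2 is thus an infimum over a larger family and is at most the one for
  \<theta>1 (\<open>theta_GH_dist_antimono\<close>). Being nonnegative, it is squeezed to 0.\<close>

lemma theta_metric_space_mono:
  assumes "theta_metric_space \<theta>1 M d" "\<theta>1 \<le> \<theta>2"
  shows "theta_metric_space \<theta>2 M d"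
proof -
  interpret theta_metric_space \<theta>1 M d by fact
  show ?thesis
  proof unfold_locales
    fix x y assume "x \<in> M" "y \<in> M"
    then show "d x y \<le> \<theta>2 * d y x"
      \<comment> \<open>The factor \<theta>1 may grow to \<theta>2 because \<open>d y x\<close> is
        nonnegative.\<close>
      using theta_bound[of x y] mult_right_mono[OF assms(2) nonneg[of y x]] by linarith
  qed
qed

text \<open>The forward topology depends on \<open>M\<close> and \<open>d\<close> alone, so
  compactness is unaffected by the change of \<theta>.\<close>

lemma compact_theta_metric_space_mono:
  assumes "compact_theta_metric_space \<theta>1 M d" "\<theta>1 \<le> \<theta>2"
  shows "compact_theta_metric_space \<theta>2 M d"
  using assms(1) unfolding compact_theta_metric_space_def
  by (auto intro: theta_metric_space_mono[OF _ assms(2)])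

lemma theta_admissible_mono:
  assumes "theta_admissible \<theta>1 M1 d1 M2 d2 d" "\<theta>1 \<le> \<theta>2"
  shows "theta_admissible \<theta>2 M1 d1 M2 d2 d"
  using assms(1) unfolding theta_admissible_def
  by (auto intro: theta_metric_space_mono[OF _ assms(2)])

text \<open>The Hausdorff distance being minimised does not involve \<theta>; only the set of
  competing metrics grows.\<close>

lemma theta_GH_dist_antimono:
  assumes "\<theta>1 \<le> \<theta>2"
  shows "theta_GH_dist \<theta>2 M1 d1 M2 d2 \<le> theta_GH_dist \<theta>1 M1 d1 M2 d2"
  unfolding theta_GH_dist_def
  using assms by (intro INF_superset_mono) (auto intro: theta_admissible_mono)

text \<open>Every competing radius is positive, and an empty infimum is infinity. This yields the
  lower bound for the squeeze.\<close>

lemma irreversible_hausdorff_nonneg: "0 \<le> irreversible_hausdorff M d A B"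
  unfolding irreversible_hausdorff_def by (rule Inf_greatest) auto

lemma theta_GH_dist_nonneg: "0 \<le> theta_GH_dist \<theta> M1 d1 M2 d2"
  unfolding theta_GH_dist_def by (intro INF_greatest irreversible_hausdorff_nonneg)

theorem proposition3p9:
  fixes \<theta>1 \<theta>2 :: real
    and X :: "nat \<Rightarrow> 'a set" and dX :: "nat \<Rightarrow> 'a \<Rightarrow> 'a \<Rightarrow> real"
    and Y :: "'b set" and dY :: "'b \<Rightarrow> 'b \<Rightarrow> real"
  assumes "1 \<le> \<theta>1" and "\<theta>1 \<le> \<theta>2"
    and "\<And>i. compact_theta_metric_space \<theta>1 (X i) (dX i)"
    and "theta_GH_converges \<theta>1 X dX Y dY"
  shows "theta_GH_converges \<theta>2 X dX Y dY"
proof -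
  have Y: "compact_theta_metric_space \<theta>1 Y dY"
    and lim: "(\<lambda>i. theta_GH_dist \<theta>1 (X i) (dX i) Y dY) \<longlonglongrightarrow> 0"
    using assms(4) by (auto simp: theta_GH_converges_def)
  have "(\<lambda>i. theta_GH_dist \<theta>2 (X i) (dX i) Y dY) \<longlonglongrightarrow> 0"
    \<comment> \<open>The bounds are the constant 0 and the \<theta>1-distance, both valid for every
      \<open>i\<close>.\<close>
    by (rule tendsto_sandwich[OF always_eventually always_eventually tendsto_const lim])
      (intro allI theta_GH_dist_nonneg theta_GH_dist_antimono[OF assms(2)])+
  then show ?thesis
    unfolding theta_GH_converges_def
    by (intro conjI allI compact_theta_metric_space_mono[OF assms(3) assms(2)]
        compact_theta_metric_space_mono[OF Y assms(2)])
qed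

end
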